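(* Consider the system $$x'=y,\qquad y'=\rho z^2\cos x+(z^2+\kappa)\sin x\cos x-\sin x-\varepsilon y,\qquad z'=\alpha(\cos x-\beta)$$ with $\rho=0$, $\beta\in(0,1)$, $\alpha>0$ and $\kappa\in[0,1)$. Then: (i) the equilibrium point is $P_0=\big(\arccos\beta,\,0,\,(1/\beta-\kappa)^{1/2}\big)$; (ii) the critical value is $\varepsilon_c=2\alpha\beta^{3/2}(1-\kappa\beta)^{1/2}$; (iii) at $\varepsilon=\varepsilon_c$, the first Lyapunov coefficient $l_1(\beta,\alpha,0,\kappa)$ at $P_0$ vanishes if and only if $G_1(\beta,\alpha,\kappa)=0$, where $$G_1(\beta,\alpha,\kappa)=-3+5\kappa\beta-(\alpha^2-5)\beta^2+\kappa(\alpha^2-7)\beta^3-2\alpha^2\kappa^2\beta^4-(\alpha^4-2\alpha^2\kappa^2)\beta^6+\alpha^4\kappa\beta^7.$$ Consequently, if $G_1(\beta,\alpha,\kappa)\neq0$, then the family (with parameter $\varepsilon$) has a transversal Hopf point at $P_0$ for $\varepsilon=\varepsilon_c$ with nonzero first Lyapunov coefficient.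
   Context: In general, for $\rho\ge0$, the equilibrium point and critical value are $$P_0=\Big(\arccos\beta,0,\frac{(1-\kappa\beta)^{1/2}(1-\beta^2)^{1/4}}{\beta^{1/2}(\rho+(1-\beta^2)^{1/2})^{1/2}}\Big),\qquad \varepsilon_c=\frac{2\alpha\beta^{3/2}(1-\beta^2)^{3/4}(1-\kappa\beta)^{1/2}(\rho+(1-\beta^2)^{1/2})^{3/2}}{(1-\beta^2)^{3/2}+\rho(1-\kappa\beta^3)}.$$ The frequency is $$\omega_0=\sqrt{\frac{(1-\beta^2)^{3/2}+\rho(1-\kappa\beta^3)}{\beta(\rho+(1-\beta^2)^{1/2})}},\qquad \omega_1=\sqrt{(1-\beta^2)/\beta}.$$ At $\varepsilon=\varepsilon_c$, the Jacobian $A=Df(P_0)$ has eigenvalues $-\varepsilon_c$ and $\pm i\omega_0$. First Lyapunov coefficient. Let $B$ and $C$ be the second- and third-derivative multilinear forms of the vector field $f$ at $P_0$. Take $q=(-i,\omega_0,\alpha\beta^{1/2}\omega_1/\omega_0)$, and let $p$ satisfy $A^{\top}p=-i\omega_0p$ and $\sum_i\bar p_iq_i=1$. Set $$G_{21}=\langle p,C(q,q,\bar q)+B(\bar q,(2i\omega_0I-A)^{-1}B(q,q))-2B(q,A^{-1}B(q,\bar q))\rangle.$$ Then $l_1=\operatorname{Re}G_{21}/(2\omega_0)$. A Hopf point is an equilibrium whose Jacobian has a pair of purely imaginary eigenvalues $\pm i\omega_0$, $\omega_0>0$, and no other eigenvalues on the imaginary axis. It is transversal if the real part of the continued complex pair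 has nonzero derivative with respect to the parameter ($\varepsilon$ here). *)

theory Defs
  imports "HOL-Analysis.Analysis"
begin

definition sys :: "real \<Rightarrow> real \<Rightarrow> real \<Rightarrow> real \<Rightarrow> real \<Rightarrow> real^3 \<Rightarrow> real^3" where
  "sys \<rho> \<kappa> \<alpha> \<beta> \<epsilon> X =
     vector [X$2,
             \<rho> * (X$3)^2 * cos (X$1) + ((X$3)^2 + \<kappa>) * sin (X$1) * cos (X$1) - sin (X$1) - \<epsilon> * X$2,
             \<alpha> * (cos (X$1) - \<beta>)]"

definition pd1 :: "(real^'n \<Rightarrow> real) \<Rightarrow> real^'n \<Rightarrow> 'n \<Rightarrow> real" where
  "pd1 g x j = deriv (\<lambda>t. g (x + t *\<^sub>R axis j 1)) 0"

definition pd2 :: "(real^'n \<Rightarrow> real) \<Rightarrow> real^'n \<Rightarrow> 'n \<Rightarrow> 'n \<Rightarrow> real" where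
  "pd2 g x j k = pd1 (\<lambda>y. pd1 g y j) x k"

definition pd3 :: "(real^'n \<Rightarrow> real) \<Rightarrow> real^'n \<Rightarrow> 'n \<Rightarrow> 'n \<Rightarrow> 'n \<Rightarrow> real" where
  "pd3 g x j k l = pd1 (\<lambda>y. pd2 g y j k) x l"

definition jac :: "(real^'n \<Rightarrow> real^'n) \<Rightarrow> real^'n \<Rightarrow> real^'n^'n" where
  "jac F x = (\<chi> i j. pd1 (\<lambda>y. F y $ i) x j)"

definition Bform :: "(real^'n \<Rightarrow> real^'n) \<Rightarrow> real^'n \<Rightarrow> complex^'n \<Rightarrow> complex^'n \<Rightarrow> complex^'n" where
  "Bform F x u v = (\<chi> i. \<Sum>j\<in>UNIV. \<Sum>k\<in>UNIV.
      complex_of_real (pd2 (\<lambda>y. F y $ i) x j k) * u$j * v$k)"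

definition Cform :: "(real^'n \<Rightarrow> real^'n) \<Rightarrow> real^'n \<Rightarrow> complex^'n \<Rightarrow> complex^'n \<Rightarrow> complex^'n \<Rightarrow> complex^'n" where
  "Cform F x u v w = (\<chi> i. \<Sum>j\<in>UNIV. \<Sum>k\<in>UNIV. \<Sum>l\<in>UNIV.
      complex_of_real (pd3 (\<lambda>y. F y $ i) x j k l) * u$j * v$k * w$l)"

definition cmat :: "real^'n^'m \<Rightarrow> complex^'n^'m" where
  "cmat A = (\<chi> i j. complex_of_real (A$i$j))"

definition cvec_cnj :: "complex^'n \<Rightarrow> complex^'n" where
  "cvec_cnj v = (\<chi> i. cnj (v$i))"

definition cpair :: "complex^'n \<Rightarrow> complex^'n \<Rightarrow> complex" where
  "cpair p v = (\<Sum>i\<in>UNIV. cnj (p$i) * v$i)"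

definition is_eigenvalue :: "complex^'n^'n \<Rightarrow> complex \<Rightarrow> bool" where
  "is_eigenvalue M \<mu> \<longleftrightarrow> (\<exists>v. v \<noteq> 0 \<and> M *v v = \<mu> *s v)"

definition hopf_jacobian :: "real^'n^'n \<Rightarrow> real \<Rightarrow> bool" where
  "hopf_jacobian A \<omega> \<longleftrightarrow> \<omega> > 0 \<and>
     is_eigenvalue (cmat A) (\<i> * of_real \<omega>) \<and> is_eigenvalue (cmat A) (- \<i> * of_real \<omega>) \<and>
     (\<forall>\<mu>. is_eigenvalue (cmat A) \<mu> \<and> Re \<mu> = 0 \<longrightarrow> \<mu> = \<i> * of_real \<omega> \<or> \<mu> = - \<i> * of_real \<omega>)"

definition transversal :: "(real \<Rightarrow> real^'n^'n) \<Rightarrow> real \<Rightarrow> real \<Rightarrow> bool" where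
  "transversal Afam e0 \<omega> \<longleftrightarrow>
     (\<exists>\<mu> :: real \<Rightarrow> complex. \<mu> e0 = \<i> * of_real \<omega> \<and> continuous (at e0) \<mu> \<and>
        (\<forall>\<^sub>F e in at e0. is_eigenvalue (cmat (Afam e)) (\<mu> e)) \<and>
        (\<exists>d. ((\<lambda>e. Re (\<mu> e)) has_real_derivative d) (at e0) \<and> d \<noteq> 0))"

definition G21 :: "(real^'n \<Rightarrow> real^'n) \<Rightarrow> real^'n \<Rightarrow> real \<Rightarrow> complex^'n \<Rightarrow> complex^'n \<Rightarrow> complex" where
  "G21 F x \<omega> q p =
     (let A = cmat (jac F x); B = Bform F x; C = Cform F x; qb = cvec_cnj q in
      cpair p (C q q qb
               + B qb (matrix_inv (mat (2 * \<i> * of_real \<omega>) - A) *v B q q)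
               - 2 *s B q (matrix_inv A *v B q qb)))"

definition lyap1 :: "(real^'n \<Rightarrow> real^'n) \<Rightarrow> real^'n \<Rightarrow> real \<Rightarrow> complex^'n \<Rightarrow> complex^'n \<Rightarrow> real" where
  "lyap1 F x \<omega> q p = Re (G21 F x \<omega> q p) / (2 * \<omega>)"

definition adj_vec :: "real^'n^'n \<Rightarrow> real \<Rightarrow> complex^'n \<Rightarrow> complex^'n \<Rightarrow> bool" where
  "adj_vec A \<omega> q p \<longleftrightarrow> transpose (cmat A) *v p = (- \<i> * of_real \<omega>) *s p \<and> cpair p q = 1"

end

theory Submission
  imports Defs
begin

text \<open>At \<open>\<rho> = 0\<close> the equilibrium \<open>P0\<close> has \<open>cos x = \<beta>\<close>, and the Jacobian there is
  \<open>Jmat (w^2) \<epsilon> Q S = [[0,1,0],[-w^2,-\<epsilon>,Q],[-S,0,0]]\<close> with characteristic polynomial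
  \<open>\<mu>^3 + \<epsilon> \<mu>^2 + w^2 \<mu> + Q S\<close>. It has a root \<open>i \<omega>\<close> with \<open>\<omega> > 0\<close> iff \<open>\<omega> = w\<close> and
  \<open>Q S = \<epsilon> w^2\<close>, i.e. \<open>\<epsilon> = \<epsilon>c\<close>; the third root is then \<open>-\<epsilon>c\<close>. Following this real root
  \<open>l \<epsilon>\<close> by the inverse function theorem, the complex pair has real part \<open>-(\<epsilon> + l \<epsilon>)/2\<close>,
  whose derivative at \<open>\<epsilon>c\<close> is \<open>-w^2 / (2 (\<epsilon>c^2 + w^2)) \<noteq> 0\<close>.

  Only the second and third components of the field are nonlinear, and they depend on \<open>x\<close> and
  \<open>z\<close> alone, so \<open>B\<close> and \<open>C\<close> have few coefficients. Solving \<open>A h11 = B(q, conj q)\<close> and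
  \<open>(2 i \<omega> - A) h20 = B(q, q)\<close> explicitly and pairing with the adjoint eigenvector, which is
  determined by its second entry, turns \<open>G21\<close> into an explicit rational function. Its real part
  is \<open>4 \<alpha> s^2 G1 / (\<beta> z0 (w^2 + \<epsilon>c^2) (4 w^2 + \<epsilon>c^2))\<close> with \<open>s = sin x\<close> and \<open>z0\<close> the
  \<open>z\<close>-coordinate of \<open>P0\<close>, so \<open>l1\<close> vanishes exactly when \<open>G1\<close> does.\<close>

section \<open>Partial derivatives of the vector field\<close>

lemma pd1_coordinates:
  fixes h hx hy hz :: "real \<Rightarrow> real \<Rightarrow> real \<Rightarrow> real"
  assumes dx: "\<And>x y z. ((\<lambda>t. h t y z) has_real_derivative hx x y z) (at x)"
    and dy: "\<And>x y z. ((\<lambda>t. h x t z) has_real_derivative hy x y z) (at y)"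
    and dz: "\<And>x y z. ((\<lambda>t. h x y t) has_real_derivative hz x y z) (at z)"
  shows "pd1 (\<lambda>X::real^3. h (X$1) (X$2) (X$3)) = (\<lambda>X j.
           if j = 1 then hx (X$1) (X$2) (X$3) else if j = 2 then hy (X$1) (X$2) (X$3)
           else hz (X$1) (X$2) (X$3))"
proof (intro ext)
  fix X :: "real^3" and j :: 3
  have shift: "((\<lambda>t. g (c + t)) has_real_derivative D) (at 0)"
    if "(g has_real_derivative D) (at c)" for g :: "real \<Rightarrow> real" and c D
    using that DERIV_shift[of g D 0 c] by (simp add: add.commute)
  consider "j = 1" | "j = 2" | "j = 3" using exhaust_3 by blast
  then show "pd1 (\<lambda>X::real^3. h (X$1) (X$2) (X$3)) X j = (if j = 1 then hx (X$1) (X$2) (X$3)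
      else if j = 2 then hy (X$1) (X$2) (X$3) else hz (X$1) (X$2) (X$3))"
    by cases (auto simp: pd1_def axis_def intro!: DERIV_imp_deriv shift dx dy dz)
qed

lemma pd1_coordinates_xz:
  fixes h hx hz :: "real \<Rightarrow> real \<Rightarrow> real"
  assumes "\<And>x z. ((\<lambda>t. h t z) has_real_derivative hx x z) (at x)"
    and "\<And>x z. ((\<lambda>t. h x t) has_real_derivative hz x z) (at z)"
  shows "pd1 (\<lambda>X::real^3. h (X$1) (X$3)) =
           (\<lambda>X j. if j = 1 then hx (X$1) (X$3) else if j = 2 then 0 else hz (X$1) (X$3))"
  using pd1_coordinates[of "\<lambda>x y z. h x z" "\<lambda>x y z. hx x z" "\<lambda>x y z. 0" "\<lambda>x y z. hz x z"] assms
  by simp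

lemma pd1_coordinate_x:
  fixes h h' :: "real \<Rightarrow> real"
  assumes "\<And>x. (h has_real_derivative h' x) (at x)"
  shows "pd1 (\<lambda>X::real^3. h (X$1)) = (\<lambda>X j. if j = 1 then h' (X$1) else 0)"
  using pd1_coordinates_xz[of "\<lambda>x z. h x" "\<lambda>x z. h' x" "\<lambda>x z. 0"] assms
  by (auto simp: fun_eq_iff)

text \<open>The second and third components of the field at \<open>\<rho> = 0\<close> and their partial derivatives;
  suffixes name the differentiation variables \<open>x = X$1\<close> and \<open>z = X$3\<close>.\<close>

definition sys2 :: "real \<Rightarrow> real \<Rightarrow> real \<Rightarrow> real \<Rightarrow> real \<Rightarrow> real" where
  "sys2 \<kappa> \<epsilon> x y z = (z^2 + \<kappa>) * sin x * cos x - sin x - \<epsilon> * y"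
definition sys2_x :: "real \<Rightarrow> real \<Rightarrow> real \<Rightarrow> real" where
  "sys2_x \<kappa> x z = (z^2 + \<kappa>) * cos (2*x) - cos x"
definition sys2_z :: "real \<Rightarrow> real \<Rightarrow> real" where
  "sys2_z x z = z * sin (2*x)"
definition sys2_xx :: "real \<Rightarrow> real \<Rightarrow> real \<Rightarrow> real" where
  "sys2_xx \<kappa> x z = - 2 * (z^2 + \<kappa>) * sin (2*x) + sin x"
definition sys2_xz :: "real \<Rightarrow> real \<Rightarrow> real" where
  "sys2_xz x z = 2 * z * cos (2*x)"
definition sys2_zz :: "real \<Rightarrow> real" where
  "sys2_zz x = sin (2*x)"
definition sys2_xxx :: "real \<Rightarrow> real \<Rightarrow> real \<Rightarrow> real" where
  "sys2_xxx \<kappa> x z = - 4 * (z^2 + \<kappa>) * cos (2*x) + cos x"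
definition sys2_xxz :: "real \<Rightarrow> real \<Rightarrow> real" where
  "sys2_xxz x z = - 4 * z * sin (2*x)"
definition sys2_xzz :: "real \<Rightarrow> real" where
  "sys2_xzz x = 2 * cos (2*x)"
definition sys3 :: "real \<Rightarrow> real \<Rightarrow> real \<Rightarrow> real" where
  "sys3 \<alpha> \<beta> x = \<alpha> * (cos x - \<beta>)"
definition sys3_x :: "real \<Rightarrow> real \<Rightarrow> real" where
  "sys3_x \<alpha> x = - \<alpha> * sin x"
definition sys3_xx :: "real \<Rightarrow> real \<Rightarrow> real" where
  "sys3_xx \<alpha> x = - \<alpha> * cos x"
definition sys3_xxx :: "real \<Rightarrow> real \<Rightarrow> real" where
  "sys3_xxx \<alpha> x = \<alpha> * sin x"

lemma pd1_const: "pd1 (\<lambda>X::real^3. c) = (\<lambda>X j. 0)"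
  using pd1_coordinates_xz[of "\<lambda>x z. c" "\<lambda>x z. 0" "\<lambda>x z. 0"] by (auto intro!: ext)

lemma pd1_y: "pd1 (\<lambda>X::real^3. X$2) = (\<lambda>X j. if j = 2 then 1 else 0)"
  using pd1_coordinates[of "\<lambda>x y z. y" "\<lambda>x y z. 0" "\<lambda>x y z. 1" "\<lambda>x y z. 0"] by (auto intro!: ext)

lemma pd1_sys2: "pd1 (\<lambda>X::real^3. sys2 \<kappa> \<epsilon> (X$1) (X$2) (X$3)) = (\<lambda>X j.
    if j = 1 then sys2_x \<kappa> (X$1) (X$3) else if j = 2 then - \<epsilon> else sys2_z (X$1) (X$3))"
  by (rule pd1_coordinates[of _ "\<lambda>x y z. sys2_x \<kappa> x z" "\<lambda>x y z. - \<epsilon>" "\<lambda>x y z. sys2_z x z", simplified])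
    (unfold sys2_def sys2_x_def sys2_z_def cos_double sin_double,
     auto simp: power2_eq_square algebra_simps intro!: derivative_eq_intros)


lemma pd1_sys2_x: "pd1 (\<lambda>X::real^3. sys2_x \<kappa> (X$1) (X$3)) = (\<lambda>X j.
    if j = 1 then sys2_xx \<kappa> (X$1) (X$3) else if j = 2 then 0 else sys2_xz (X$1) (X$3))"
  by (rule pd1_coordinates_xz)
    (unfold sys2_x_def sys2_xx_def sys2_xz_def cos_double sin_double,
     auto simp: power2_eq_square algebra_simps intro!: derivative_eq_intros)

lemma pd1_sys2_z: "pd1 (\<lambda>X::real^3. sys2_z (X$1) (X$3)) = (\<lambda>X j.
    if j = 1 then sys2_xz (X$1) (X$3) else if j = 2 then 0 else sys2_zz (X$1))"
  by (rule pd1_coordinates_xz)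
    (unfold sys2_z_def sys2_xz_def sys2_zz_def, auto intro!: derivative_eq_intros)

lemma pd1_sys2_xx: "pd1 (\<lambda>X::real^3. sys2_xx \<kappa> (X$1) (X$3)) = (\<lambda>X j.
    if j = 1 then sys2_xxx \<kappa> (X$1) (X$3) else if j = 2 then 0 else sys2_xxz (X$1) (X$3))"
  by (rule pd1_coordinates_xz)
    (unfold sys2_xx_def sys2_xxx_def sys2_xxz_def, auto intro!: derivative_eq_intros)

lemma pd1_sys2_xz: "pd1 (\<lambda>X::real^3. sys2_xz (X$1) (X$3)) = (\<lambda>X j.
    if j = 1 then sys2_xxz (X$1) (X$3) else if j = 2 then 0 else sys2_xzz (X$1))"
  by (rule pd1_coordinates_xz)
    (unfold sys2_xz_def sys2_xxz_def sys2_xzz_def, auto intro!: derivative_eq_intros)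

lemma pd1_sys2_zz: "pd1 (\<lambda>X::real^3. sys2_zz (X$1)) = (\<lambda>X j.
    if j = 1 then sys2_xzz (X$1) else 0)"
  by (rule pd1_coordinate_x)
    (unfold sys2_zz_def sys2_xzz_def, auto intro!: derivative_eq_intros)

lemma pd1_sys3: "pd1 (\<lambda>X::real^3. sys3 \<alpha> \<beta> (X$1)) = (\<lambda>X j.
    if j = 1 then sys3_x \<alpha> (X$1) else 0)"
  by (rule pd1_coordinate_x)
    (unfold sys3_def sys3_x_def, auto intro!: derivative_eq_intros)

lemma pd1_sys3_x: "pd1 (\<lambda>X::real^3. sys3_x \<alpha> (X$1)) = (\<lambda>X j.
    if j = 1 then sys3_xx \<alpha> (X$1) else 0)"
  by (rule pd1_coordinate_x)
    (unfold sys3_x_def sys3_xx_def, auto intro!: derivative_eq_intros)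

lemma pd1_sys3_xx: "pd1 (\<lambda>X::real^3. sys3_xx \<alpha> (X$1)) = (\<lambda>X j.
    if j = 1 then sys3_xxx \<alpha> (X$1) else 0)"
  by (rule pd1_coordinate_x)
    (unfold sys3_xx_def sys3_xxx_def, auto intro!: derivative_eq_intros)

lemmas pd1_sys_table = pd1_const pd1_y pd1_sys2 pd1_sys2_x pd1_sys2_z pd1_sys2_xx pd1_sys2_xz
  pd1_sys2_zz pd1_sys3 pd1_sys3_x pd1_sys3_xx

lemma sys_components:
  "(\<lambda>X. sys 0 \<kappa> \<alpha> \<beta> \<epsilon> X $ 1) = (\<lambda>X. X$2)"
  "(\<lambda>X. sys 0 \<kappa> \<alpha> \<beta> \<epsilon> X $ 2) = (\<lambda>X. sys2 \<kappa> \<epsilon> (X$1) (X$2) (X$3))"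
  "(\<lambda>X. sys 0 \<kappa> \<alpha> \<beta> \<epsilon> X $ 3) = (\<lambda>X. sys3 \<alpha> \<beta> (X$1))"
  by (auto simp: sys_def sys2_def sys3_def)

text \<open>The forms \<open>B\<close> and \<open>C\<close> of such a field: \<open>bxx, bxz, bzz\<close> and \<open>dxxx, dxxz, dxzz\<close>
  are partial derivatives of the second component, \<open>cxx\<close> and \<open>exxx\<close> of the third.\<close>

definition bilin_xz :: "real \<Rightarrow> real \<Rightarrow> real \<Rightarrow> real \<Rightarrow> complex^3 \<Rightarrow> complex^3 \<Rightarrow> complex^3" where
  "bilin_xz bxx bxz bzz cxx u v = vector [0,
     of_real bxx * u$1 * v$1 + of_real bxz * (u$1 * v$3 + u$3 * v$1) + of_real bzz * u$3 * v$3,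
     of_real cxx * u$1 * v$1]"

definition trilin_xz ::
    "real \<Rightarrow> real \<Rightarrow> real \<Rightarrow> real \<Rightarrow> complex^3 \<Rightarrow> complex^3 \<Rightarrow> complex^3 \<Rightarrow> complex^3" where
  "trilin_xz dxxx dxxz dxzz exxx u v w = vector [0,
     of_real dxxx * u$1 * v$1 * w$1
     + of_real dxxz * (u$1 * v$1 * w$3 + u$1 * v$3 * w$1 + u$3 * v$1 * w$1)
     + of_real dxzz * (u$1 * v$3 * w$3 + u$3 * v$1 * w$3 + u$3 * v$3 * w$1),
     of_real exxx * u$1 * v$1 * w$1]"

lemma jac_sys: "jac (sys 0 \<kappa> \<alpha> \<beta> \<epsilon>) X = vector [vector [0, 1, 0],
    vector [sys2_x \<kappa> (X$1) (X$3), - \<epsilon>, sys2_z (X$1) (X$3)], vector [sys3_x \<alpha> (X$1), 0, 0]]"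
  unfolding jac_def by (simp add: vec_eq_iff forall_3 sys_components pd1_sys_table)

lemma Bform_sys: "Bform (sys 0 \<kappa> \<alpha> \<beta> \<epsilon>) X =
    bilin_xz (sys2_xx \<kappa> (X$1) (X$3)) (sys2_xz (X$1) (X$3)) (sys2_zz (X$1)) (sys3_xx \<alpha> (X$1))"
  unfolding Bform_def pd2_def bilin_xz_def
  by (simp add: fun_eq_iff vec_eq_iff forall_3 sum_3 sys_components pd1_sys_table algebra_simps)

lemma Cform_sys: "Cform (sys 0 \<kappa> \<alpha> \<beta> \<epsilon>) X =
    trilin_xz (sys2_xxx \<kappa> (X$1) (X$3)) (sys2_xxz (X$1) (X$3)) (sys2_xzz (X$1))
      (sys3_xxx \<alpha> (X$1))"
  unfolding Cform_def pd3_def pd2_def trilin_xz_def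
  by (simp add: fun_eq_iff vec_eq_iff forall_3 sum_3 sys_components pd1_sys_table algebra_simps)

section \<open>The Jacobian at the equilibrium and its spectrum\<close>

lemma vec3_eq_iff: "(x::'a^3) = y \<longleftrightarrow> x$1 = y$1 \<and> x$2 = y$2 \<and> x$3 = y$3"
  by (simp add: vec_eq_iff forall_3)

definition Jmat :: "real \<Rightarrow> real \<Rightarrow> real \<Rightarrow> real \<Rightarrow> real^3^3" where
  "Jmat W \<epsilon> Q S = vector [vector [0, 1, 0], vector [- W, - \<epsilon>, Q], vector [- S, 0, 0]]"

lemma cmat_Jmat_mult: "cmat (Jmat W \<epsilon> Q S) *v v =
    vector [v$2, - of_real W * v$1 - of_real \<epsilon> * v$2 + of_real Q * v$3, - of_real S * v$1]"
  by (simp add: vec3_eq_iff matrix_vector_mult_def sum_3 cmat_def Jmat_def)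

lemma transpose_cmat_Jmat_mult: "transpose (cmat (Jmat W \<epsilon> Q S)) *v v =
    vector [- of_real W * v$2 - of_real S * v$3, v$1 - of_real \<epsilon> * v$2, of_real Q * v$2]"
  by (simp add: vec3_eq_iff matrix_vector_mult_def sum_3 cmat_def Jmat_def transpose_def)

lemma is_eigenvalue_Jmat_iff:
  assumes "Q \<noteq> 0" "S \<noteq> 0"
  shows "is_eigenvalue (cmat (Jmat W \<epsilon> Q S)) \<mu> \<longleftrightarrow>
    \<mu>^3 + of_real \<epsilon> * \<mu>^2 + of_real W * \<mu> + of_real (Q * S) = 0"
proof
  assume "is_eigenvalue (cmat (Jmat W \<epsilon> Q S)) \<mu>"
  then obtain v where "v \<noteq> 0" and "cmat (Jmat W \<epsilon> Q S) *v v = \<mu> *s v"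
    unfolding is_eigenvalue_def by blast
  then have v2: "v$2 = \<mu> * v$1"
    and v3: "- of_real S * v$1 = \<mu> * v$3"
    and row2: "- of_real W * v$1 - of_real \<epsilon> * v$2 + of_real Q * v$3 = \<mu> * v$2"
    and "v$1 \<noteq> 0"
    using assms by (auto simp: cmat_Jmat_mult vec3_eq_iff)
  have "(\<mu>^3 + of_real \<epsilon> * \<mu>^2 + of_real W * \<mu> + of_real (Q * S)) * v$1
      = \<mu> * (\<mu> * v$2 + of_real W * v$1 + of_real \<epsilon> * v$2 - of_real Q * v$3)"
    using v2 v3 unfolding power2_eq_square power3_eq_cube of_real_mult by algebra
  also have "\<dots> = 0"
    using row2 by (simp add: algebra_simps)
  finally have "(\<mu>^3 + of_real \<epsilon> * \<mu>^2 + of_real W * \<mu> + of_real (Q * S)) * v$1 = 0" .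
  with \<open>v$1 \<noteq> 0\<close> show "\<mu>^3 + of_real \<epsilon> * \<mu>^2 + of_real W * \<mu> + of_real (Q * S) = 0"
    by simp
next
  assume char: "\<mu>^3 + of_real \<epsilon> * \<mu>^2 + of_real W * \<mu> + of_real (Q * S) = 0"
  with assms have "\<mu> \<noteq> 0" by auto
  define v :: "complex^3" where "v = vector [\<mu>, \<mu>^2, - of_real S]"
  have "v \<noteq> 0" using \<open>\<mu> \<noteq> 0\<close> by (simp add: v_def vec3_eq_iff)
  moreover have "cmat (Jmat W \<epsilon> Q S) *v v = \<mu> *s v"
    using char unfolding v_def cmat_Jmat_mult vec3_eq_iff power2_eq_square power3_eq_cube
    by (simp add: of_real_mult) algebra
  ultimately show "is_eigenvalue (cmat (Jmat W \<epsilon> Q S)) \<mu>"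
    unfolding is_eigenvalue_def by blast
qed

lemma imaginary_eigenvalue_Jmat_iff:
  assumes "Q \<noteq> 0" "S \<noteq> 0"
  shows "is_eigenvalue (cmat (Jmat W \<epsilon> Q S)) (\<i> * of_real y) \<longleftrightarrow> Q * S = \<epsilon> * y^2 \<and> W * y = y^3"
  by (simp add: is_eigenvalue_Jmat_iff[OF assms] complex_eq_iff power2_eq_square power3_eq_cube)

lemma positive_imaginary_eigenvalue_Jmat_iff:
  assumes "w > 0" "Q \<noteq> 0" "S \<noteq> 0"
  shows "(\<exists>y>0. is_eigenvalue (cmat (Jmat (w^2) \<epsilon> Q S)) (\<i> * of_real y)) \<longleftrightarrow> Q * S = \<epsilon> * w^2"
proof -
  have "y^2 = w^2" if "y > 0" "w^2 * y = y^3" for y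
    using that by (simp add: power2_eq_square power3_eq_cube)
  then have "y = w" if "y > 0" "w^2 * y = y^3" for y
    using that assms(1) by (meson less_le power2_eq_iff_nonneg)
  then show ?thesis
    using assms(1) by (auto simp: imaginary_eigenvalue_Jmat_iff[OF assms(2,3)] power3_eq_cube power2_eq_square)
qed

lemma hopf_jacobian_Jmat:
  assumes "w > 0" "0 < Q * S" "Q * S = \<epsilon> * w^2"
  shows "hopf_jacobian (Jmat (w^2) \<epsilon> Q S) w"
proof -
  have QS: "Q \<noteq> 0" "S \<noteq> 0"
    using assms(2) by auto
  have imaginary: "is_eigenvalue (cmat (Jmat (w^2) \<epsilon> Q S)) (\<i> * of_real y) \<longleftrightarrow> y = w \<or> y = - w" for y
  proof -
    have "Q * S = \<epsilon> * y^2 \<and> w^2 * y = y^3 \<longleftrightarrow> y^2 = w^2"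
      using assms by (auto simp: power2_eq_square power3_eq_cube)
    then show ?thesis
      unfolding imaginary_eigenvalue_Jmat_iff[OF QS] power2_eq_iff by blast
  qed
  show ?thesis
    unfolding hopf_jacobian_def
  proof (intro conjI allI impI)
    show "is_eigenvalue (cmat (Jmat (w^2) \<epsilon> Q S)) (\<i> * of_real w)"
      using imaginary[of w] by simp
    show "is_eigenvalue (cmat (Jmat (w^2) \<epsilon> Q S)) (- \<i> * of_real w)"
      using imaginary[of "- w"] by simp
    fix \<mu> assume "is_eigenvalue (cmat (Jmat (w^2) \<epsilon> Q S)) \<mu> \<and> Re \<mu> = 0"
    moreover have "\<mu> = \<i> * of_real (Im \<mu>)" if "Re \<mu> = 0"
      using that by (simp add: complex_eq_iff)
    ultimately show "\<mu> = \<i> * of_real w \<or> \<mu> = - \<i> * of_real w"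
      using imaginary[of "Im \<mu>"] by auto
  qed (fact assms(1))
qed

section \<open>Transversality\<close>

lemma decreasing_local_inverse:
  fixes f f' :: "real \<Rightarrow> real"
  assumes "a < x0" "x0 < b"
    and f_deriv: "\<And>x. a \<le> x \<Longrightarrow> x \<le> b \<Longrightarrow> (f has_real_derivative f' x) (at x)"
    and f'_neg: "\<And>x. a \<le> x \<Longrightarrow> x \<le> b \<Longrightarrow> f' x < 0"
  obtains g where "g (f x0) = x0" "isCont g (f x0)"
    and "(g has_real_derivative inverse (f' x0)) (at (f x0))"
    and "\<forall>\<^sub>F y in at (f x0). a \<le> g y \<and> g y \<le> b \<and> f (g y) = y"
proof -
  have decreasing: "f y < f x" if "a \<le> x" "x < y" "y \<le> b" for x y
    using DERIV_neg_imp_decreasing[OF \<open>x < y\<close>, of f] that f_deriv f'_neg by force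
  have "continuous_on {a..b} f"
    by (auto intro!: continuous_at_imp_continuous_on DERIV_isCont f_deriv)
  then have "\<exists>x. a \<le> x \<and> x \<le> b \<and> f x = y" if "f b \<le> y" "y \<le> f a" for y
    using IVT2'[of f b y a] that assms(1,2) by auto
  then obtain g where g: "\<And>y. f b \<le> y \<Longrightarrow> y \<le> f a \<Longrightarrow> a \<le> g y \<and> g y \<le> b \<and> f (g y) = y"
    by metis
  have g_f: "g (f x) = x" if "a \<le> x" "x \<le> b" for x
  proof -
    have "f b \<le> f x" "f x \<le> f a"
      using that decreasing by (metis order.order_iff_strict)+
    then have "a \<le> g (f x)" "g (f x) \<le> b" "f (g (f x)) = f x"
      using g by auto
    then show ?thesis
      using that decreasing by (metis linorder_neqE_linordered_idom order.strict_iff_not)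
  qed
  have range: "f b < f x0" "f x0 < f a"
    using assms(1,2) decreasing by auto
  have g_cont: "isCont g (f x0)"
  proof (rule isCont_inverse_function2[OF assms(1,2)])
    show "g (f z) = z" "isCont f z" if "a \<le> z" "z \<le> b" for z
      using g_f[OF that] DERIV_isCont[OF f_deriv[OF that]] by auto
  qed
  moreover have "(g has_real_derivative inverse (f' x0)) (at (f x0))"
  proof (rule DERIV_inverse_function[OF _ _ range])
    show "(f has_real_derivative f' x0) (at (g (f x0)))"
      using assms(1,2) g_f f_deriv by simp
    show "f' x0 \<noteq> 0"
      using assms(1,2) f'_neg[of x0] by simp
    show "f (g y) = y" if "f b < y" "y < f a" for y
      using g that by simp
  qed (fact g_cont)
  moreover have "\<forall>\<^sub>F y in at (f x0). a \<le> g y \<and> g y \<le> b \<and> f (g y) = y"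
  proof -
    have "\<forall>\<^sub>F y in at (f x0). f b < y \<and> y < f a"
      using range by (intro eventually_conj order_tendstoD[OF tendsto_ident_at])
    then show ?thesis
      by eventually_elim (use g in auto)
  qed
  ultimately show ?thesis
    using g_f[of x0] assms(1,2) by (intro that) auto
qed

lemma cubic_root_from_real_root:
  fixes l \<epsilon> W c :: real
  assumes "l^3 + \<epsilon> * l^2 + W * l + c = 0"
    and "0 \<le> 4 * (W + l * (\<epsilon> + l)) - (\<epsilon> + l)^2"
  defines "\<mu> \<equiv> Complex (- (\<epsilon> + l) / 2) (sqrt (4 * (W + l * (\<epsilon> + l)) - (\<epsilon> + l)^2) / 2)"
  shows "\<mu>^3 + of_real \<epsilon> * \<mu>^2 + of_real W * \<mu> + of_real c = 0"
proof -
  define s where "s = \<epsilon> + l"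
  define d where "d = sqrt (4 * (W + l * s) - s^2)"
  have d2: "d^2 = 4 * (W + l * s) - s^2"
    using assms(2) by (simp add: d_def s_def)
  have c: "c = - (l^3) - \<epsilon> * l^2 - W * l"
    using assms(1) by simp
  have "\<mu>^2 + of_real s * \<mu> + of_real (W + l * s) = 0"
    using d2 unfolding \<mu>_def s_def[symmetric] d_def[symmetric]
    by (simp add: complex_eq_iff power2_eq_square field_simps)
  moreover have "\<mu>^3 + of_real \<epsilon> * \<mu>^2 + of_real W * \<mu> + of_real c
      = (\<mu> - of_real l) * (\<mu>^2 + of_real s * \<mu> + of_real (W + l * s))"
    unfolding c s_def by (simp add: algebra_simps power2_eq_square power3_eq_cube)
  ultimately show ?thesis
    by simp
qed

text \<open>The real root \<open>l\<close> of the characteristic polynomial solves \<open>\<epsilon> = f l\<close>, where \<open>f\<close> is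
  decreasing near \<open>-E0\<close>.\<close>

lemma real_root_branch:
  fixes W E0 :: real
  assumes W: "W > 0" and E0: "E0 > 0"
  obtains l where "l E0 = - E0" "isCont l E0"
    and "(l has_real_derivative - (E0^2) / (E0^2 + W)) (at E0)"
    and "\<forall>\<^sub>F e in at E0. (l e)^3 + e * (l e)^2 + W * l e + E0 * W = 0"
proof -
  define f where "f x = - x - W / x - E0 * W / x^2" for x :: real
  define f' where "f' x = - 1 + W / x^2 + 2 * E0 * W / x^3" for x :: real
  have f_deriv: "(f has_real_derivative f' x) (at x)" if "x \<noteq> 0" for x
    unfolding f_def f'_def using that
    by (auto intro!: derivative_eq_intros simp: field_simps power2_eq_square power3_eq_cube)
  have f'_neg: "f' x < 0" if "- 2 * E0 \<le> x" "x < 0" for x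
  proof -
    have x3: "x^3 < 0"
      using mult_pos_neg[of "x * x" x] mult_neg_neg[of x x] that by (simp add: power3_eq_cube)
    have "0 \<le> W * (x + 2 * E0)"
      using that W by (intro mult_nonneg_nonneg) auto
    moreover have "f' x * x^3 = - (x^3) + W * (x + 2 * E0)"
      using that unfolding f'_def by (simp add: field_simps power2_eq_square power3_eq_cube)
    ultimately have "0 < f' x * x^3"
      using x3 by linarith
    then show ?thesis
      using x3 by (simp add: zero_less_mult_iff)
  qed
  have "- 3/2 * E0 < - E0" "- E0 < - E0 / 2"
    using E0 by simp_all
  from decreasing_local_inverse[OF this, of f f'] f_deriv f'_neg E0
  obtain l where "l (f (- E0)) = - E0" "isCont l (f (- E0))"
    "(l has_real_derivative inverse (f' (- E0))) (at (f (- E0)))"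
    "\<forall>\<^sub>F e in at (f (- E0)). - 3/2 * E0 \<le> l e \<and> l e \<le> - E0 / 2 \<and> f (l e) = e"
    by auto
  moreover have "f (- E0) = E0" and f'_E0: "f' (- E0) = - ((E0^2 + W) / E0^2)"
    using E0 unfolding f_def f'_def by (simp_all add: field_simps power2_eq_square power3_eq_cube)
  moreover have "inverse (f' (- E0)) = - (E0^2) / (E0^2 + W)"
    unfolding f'_E0 by simp
  moreover have "(l e)^3 + e * (l e)^2 + W * l e + E0 * W = 0" if "l e < 0" "f (l e) = e" for e
  proof -
    from \<open>l e < 0\<close> have "(l e)^2 * f (l e) = - ((l e)^3) - W * l e - E0 * W"
      unfolding f_def by (simp add: field_simps power2_eq_square power3_eq_cube)
    then show ?thesis
      unfolding \<open>f (l e) = e\<close> by (simp add: algebra_simps)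
  qed
  ultimately show ?thesis
    using E0 by (intro that[of l]) (auto elim!: eventually_mono)
qed

lemma transversal_Jmat:
  assumes W: "W > 0" and E0: "E0 > 0" and "Q \<noteq> 0" "S \<noteq> 0" and QS: "Q * S = E0 * W"
  shows "transversal (\<lambda>e. Jmat W e Q S) E0 (sqrt W)"
proof -
  obtain l where l_E0: "l E0 = - E0" and l_cont: "isCont l E0"
    and l_deriv: "(l has_real_derivative - (E0^2) / (E0^2 + W)) (at E0)"
    and l_root: "\<forall>\<^sub>F e in at E0. (l e)^3 + e * (l e)^2 + W * l e + Q * S = 0"
    using real_root_branch[OF W E0] unfolding QS by blast
  define \<Delta> where "\<Delta> e = 4 * (W + l e * (e + l e)) - (e + l e)^2" for e
  define \<mu> where "\<mu> e = Complex (- (e + l e) / 2) (sqrt (\<Delta> e) / 2)" for e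
  have \<mu>_E0: "\<mu> E0 = \<i> * of_real (sqrt W)"
    using W by (simp add: \<mu>_def \<Delta>_def l_E0 complex_eq_iff real_sqrt_mult)
  have \<Delta>_cont: "isCont \<Delta> E0"
    unfolding \<Delta>_def by (intro continuous_intros l_cont)
  have \<mu>_cont: "continuous (at E0) \<mu>"
    unfolding \<mu>_def Complex_eq by (intro continuous_intros l_cont \<Delta>_cont) simp_all
  have "\<Delta> E0 = 4 * W"
    by (simp add: \<Delta>_def l_E0)
  then have "\<forall>\<^sub>F e in at E0. 0 < \<Delta> e"
    using order_tendstoD(1)[OF \<Delta>_cont[unfolded isCont_def], of 0] W by simp
  then have "\<forall>\<^sub>F e in at E0. is_eigenvalue (cmat (Jmat W e Q S)) (\<mu> e)"
    using l_root
  proof eventually_elim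
    case (elim e)
    then show ?case
      using cubic_root_from_real_root[of "l e" e W "Q * S"]
      by (simp add: is_eigenvalue_Jmat_iff assms(3,4) \<mu>_def \<Delta>_def)
  qed
  moreover have "((\<lambda>e. Re (\<mu> e)) has_real_derivative - (1 - (E0^2) / (E0^2 + W)) / 2) (at E0)"
    unfolding \<mu>_def by (auto intro!: derivative_eq_intros l_deriv)
  moreover have "- (1 - (E0^2) / (E0^2 + W)) / 2 \<noteq> 0"
    using W by (simp add: add_nonneg_pos)
  ultimately show ?thesis
    unfolding transversal_def using \<mu>_E0 \<mu>_cont by blast
qed

section \<open>The coefficient G21\<close>

lemma mat_mult_vector: "mat c *v x = c *s (x :: 'a::comm_ring_1^'n)"
  by (simp add: vec_eq_iff matrix_vector_mult_def mat_def if_distrib[where f="\<lambda>a. a * b" for b]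
      cong: if_cong)

lemma invertible_if_not_eigenvalue_0:
  fixes M :: "complex^'n^'n"
  assumes "\<not> is_eigenvalue M 0"
  shows "invertible M"
proof -
  have "x = 0" if "M *v x = 0" for x
    using that assms unfolding is_eigenvalue_def by (metis vector_smult_lzero)
  then show ?thesis
    using matrix_left_invertible_ker invertible_left_inverse by blast
qed

lemma invertible_shift_if_not_eigenvalue:
  fixes M :: "complex^'n^'n"
  assumes "\<not> is_eigenvalue M c"
  shows "invertible (mat c - M)"
proof (rule invertible_if_not_eigenvalue_0)
  show "\<not> is_eigenvalue (mat c - M) 0"
    using assms unfolding is_eigenvalue_def
    by (metis matrix_vector_mult_diff_rdistrib mat_mult_vector vector_smult_lzero eq_iff_diff_eq_0)
qed

lemma matrix_inv_mult_eq:
  fixes M :: "'a::field^'n^'n"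
  assumes "invertible M" "M *v h = y"
  shows "matrix_inv M *v y = h"
proof -
  have "matrix_inv M ** M = mat 1"
    using assms(1) unfolding invertible_def matrix_inv_def by (rule someI2_ex) auto
  then show ?thesis
    using assms(2) by (metis matrix_vector_mul_assoc matrix_vector_mul_lid)
qed

lemma adjoint_Jmat_eq:
  assumes "w \<noteq> 0" "transpose (cmat (Jmat (w^2) \<epsilon> Q S)) *v p = (- \<i> * of_real w) *s p"
  shows "p = p$2 *s vector [of_real \<epsilon> - \<i> * of_real w, 1, \<i> * of_real (Q / w)]"
proof -
  from assms(2) have row2: "p$1 - of_real \<epsilon> * p$2 = - \<i> * of_real w * p$2"
    and row3: "of_real Q * p$2 = - \<i> * of_real w * p$3"
    unfolding transpose_cmat_Jmat_mult vec3_eq_iff by simp_all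
  have "p$1 = (of_real \<epsilon> - \<i> * of_real w) * p$2"
    using row2 by (simp add: algebra_simps)
  moreover have "of_real w * p$3 = \<i> * of_real Q * p$2"
    using row3 i_squared by algebra
  ultimately show ?thesis
    using assms(1) by (simp add: vec3_eq_iff field_simps)
qed

lemma cpair_adjoint_Jmat:
  assumes "w > 0" "Q * S = \<epsilon> * w^2"
    and "transpose (cmat (Jmat (w^2) \<epsilon> Q S)) *v p = (- \<i> * of_real w) *s p"
    and "cpair p (vector [- \<i>, of_real w, of_real (S / w)]) = 1"
    and "v$1 = 0"
  shows "cpair p v = (v$2 - \<i> * of_real (Q / w) * v$3) / (2 * (of_real w - \<i> * of_real \<epsilon>))"
proof -
  let ?c = "cnj (p$2)"
  have p: "p = p$2 *s vector [of_real \<epsilon> - \<i> * of_real w, 1, \<i> * of_real (Q / w)]"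
    using assms by (intro adjoint_Jmat_eq) auto
  have QS: "of_real Q * of_real S = (of_real \<epsilon> * of_real w * of_real w :: complex)"
    using assms(2) by (simp add: power2_eq_square flip: of_real_mult)
  have pair: "cpair p u = ?c * ((of_real \<epsilon> + \<i> * of_real w) * u$1 + u$2 - \<i> * of_real (Q / w) * u$3)"
    for u
    by (subst p) (simp add: cpair_def sum_3 algebra_simps)
  have "of_real w - \<i> * of_real \<epsilon> \<noteq> 0"
    using assms(1) by (simp add: complex_eq_iff)
  moreover have "?c * (2 * (of_real w - \<i> * of_real \<epsilon>)) = 1"
    using pair[of "vector [- \<i>, of_real w, of_real (S / w)]"] assms(1,4) QS
    by (simp add: field_simps)
  ultimately have "?c = 1 / (2 * (of_real w - \<i> * of_real \<epsilon>))"
    by (simp add: field_simps)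
  then show ?thesis
    using pair[of v] assms(5) by simp
qed

lemma adjoint_exists_Jmat:
  assumes "w > 0" "Q * S = \<epsilon> * w^2"
  shows "\<exists>p. transpose (cmat (Jmat (w^2) \<epsilon> Q S)) *v p = (- \<i> * of_real w) *s p
           \<and> cpair p (vector [- \<i>, of_real w, of_real (S / w)]) = 1"
proof -
  have nz: "of_real w + \<i> * of_real \<epsilon> \<noteq> 0"
    using assms(1) by (simp add: complex_eq_iff)
  define c where "c = 1 / (2 * (of_real w + \<i> * of_real \<epsilon>))"
  define p :: "complex^3" where "p = c *s vector [of_real \<epsilon> - \<i> * of_real w, 1, \<i> * of_real (Q / w)]"
  have QS: "of_real Q * of_real S = (of_real \<epsilon> * of_real w * of_real w :: complex)"
    using assms(2) by (simp add: power2_eq_square flip: of_real_mult)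
  have "transpose (cmat (Jmat (w^2) \<epsilon> Q S)) *v p = (- \<i> * of_real w) *s p"
    using assms(1) QS unfolding p_def transpose_cmat_Jmat_mult vec3_eq_iff
    by (simp add: field_simps power2_eq_square)
  moreover have "cnj c * (2 * (of_real w - \<i> * of_real \<epsilon>)) = 1"
    using nz assms(1) by (simp add: c_def field_simps)
  then have "cpair p (vector [- \<i>, of_real w, of_real (S / w)]) = 1"
    using assms(1) QS unfolding p_def cpair_def by (simp add: sum_3 field_simps)
  ultimately show ?thesis
    by blast
qed

lemma bilin_xz_Jmat_inverse:
  fixes w \<sigma> bxx bxz bzz cxx :: real
  assumes "Q \<noteq> 0" "S \<noteq> 0"
  defines "q \<equiv> vector [- \<i>, of_real w, of_real \<sigma>] :: complex^3"
  shows "matrix_inv (cmat (Jmat W \<epsilon> Q S)) *v bilin_xz bxx bxz bzz cxx q (cvec_cnj q)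
           = vector [of_real (- cxx / S), 0, of_real ((bxx + bzz * \<sigma>^2 - W * cxx / S) / Q)]"
  (is "_ = vector [of_real ?u, 0, of_real ?t]")
proof (rule matrix_inv_mult_eq)
  show "invertible (cmat (Jmat W \<epsilon> Q S))"
    using assms(1,2) by (intro invertible_if_not_eigenvalue_0) (simp add: is_eigenvalue_Jmat_iff)
  define u where "u = - cxx / S"
  define t where "t = (bxx + bzz * \<sigma>^2 - W * cxx / S) / Q"
  have "- W * u + Q * t = bxx + bzz * \<sigma>^2" "- S * u = cxx"
    using assms(1,2) by (simp_all add: u_def t_def field_simps)
  \<comment> \<open>stated in the literal shape of the unfolded components, so that rewriting alone closes the goal\<close>
  then have rows: "- of_real W * of_real u - of_real \<epsilon> * 0 + of_real Q * of_real t
      = of_real bxx * - \<i> * cnj (- \<i>) + of_real bxz * (- \<i> * cnj (of_real \<sigma>) + of_real \<sigma> * cnj (- \<i>))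
        + of_real bzz * of_real \<sigma> * cnj (of_real \<sigma>)"
    "- of_real S * of_real u = of_real cxx * - \<i> * cnj (- \<i>)"
    by (simp_all add: complex_eq_iff power2_eq_square)
  show "cmat (Jmat W \<epsilon> Q S) *v vector [of_real ?u, 0, of_real ?t] = bilin_xz bxx bxz bzz cxx q (cvec_cnj q)"
    unfolding u_def[symmetric] t_def[symmetric] cmat_Jmat_mult bilin_xz_def q_def cvec_cnj_def vec3_eq_iff
    by (simp only: vector_3 vec_lambda_beta rows simp_thms)
qed

lemma bilin_xz_Jmat_resolvent:
  fixes w \<sigma> \<epsilon> Q S bxx bxz bzz cxx :: real
  assumes "w > 0" "Q \<noteq> 0" "S \<noteq> 0" "Q * S = \<epsilon> * w^2"
  defines "q \<equiv> vector [- \<i>, of_real w, of_real \<sigma>] :: complex^3"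
    and "h \<equiv> Complex (- bxx + \<sigma>^2 * bzz) (- 2 * \<sigma> * bxz + Q * cxx / (2 * w))
               / Complex (- 3 * w^2) (3/2 * w * \<epsilon>)"
  shows "matrix_inv (mat (2 * \<i> * of_real w) - cmat (Jmat (w^2) \<epsilon> Q S)) *v bilin_xz bxx bxz bzz cxx q q
           = vector [h, 2 * \<i> * of_real w * h, \<i> * (of_real cxx + of_real S * h) / (2 * of_real w)]"
proof (rule matrix_inv_mult_eq)
  have QS: "of_real Q * of_real S = (of_real \<epsilon> * of_real w * of_real w :: complex)"
    using assms(4) by (simp add: power2_eq_square flip: of_real_mult)
  show "invertible (mat (2 * \<i> * of_real w) - cmat (Jmat (w^2) \<epsilon> Q S))"
  proof (rule invertible_shift_if_not_eigenvalue)
    show "\<not> is_eigenvalue (cmat (Jmat (w^2) \<epsilon> Q S)) (2 * \<i> * of_real w)"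
    proof
      let ?\<mu> = "2 * \<i> * of_real w"
      assume "is_eigenvalue (cmat (Jmat (w^2) \<epsilon> Q S)) ?\<mu>"
      then have "Im (?\<mu>^3 + of_real \<epsilon> * ?\<mu>^2 + of_real (w^2) * ?\<mu> + of_real (Q * S)) = 0"
        using assms(2,3) by (simp add: is_eigenvalue_Jmat_iff)
      moreover have "Im (?\<mu>^3 + of_real \<epsilon> * ?\<mu>^2 + of_real (w^2) * ?\<mu> + of_real (Q * S)) = - 6 * w^3"
        by (simp add: power2_eq_square power3_eq_cube)
      ultimately show False
        using assms(1) by simp
    qed
  qed
  have "Complex (- 3 * w^2) (3/2 * w * \<epsilon>) \<noteq> 0"
    using assms(1) by (simp add: Complex_eq_0)
  then have "Complex (- 3 * w^2) (3/2 * w * \<epsilon>) * h = Complex (- bxx + \<sigma>^2 * bzz) (- 2 * \<sigma> * bxz + Q * cxx / (2 * w))"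
    by (simp add: h_def)
  then have hD: "(- 3 * of_real (w^2) + 3/2 * \<i> * of_real (w * \<epsilon>)) * h
      = - of_real bxx - 2 * \<i> * of_real (\<sigma> * bxz) + of_real (\<sigma>^2 * bzz) + \<i> * of_real (Q * cxx / (2 * w))"
    by (simp add: Complex_eq algebra_simps)
  define g where "g = \<i> * (of_real cxx + of_real S * h) / (2 * of_real w)"
  have QSg: "of_real Q * g = \<i> * of_real (Q * cxx / (2 * w)) + \<i> * of_real (w * \<epsilon>) / 2 * h"
    using assms(1) QS by (simp add: g_def field_simps)
  have row2: "2 * \<i> * of_real w * (2 * \<i> * of_real w * h)
        - (- of_real (w^2) * h - of_real \<epsilon> * (2 * \<i> * of_real w * h) + of_real Q * g)
      = of_real bxx * - \<i> * - \<i> + of_real bxz * (- \<i> * of_real \<sigma> + of_real \<sigma> * - \<i>)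
        + of_real bzz * of_real \<sigma> * of_real \<sigma>"
  proof -
    have "2 * \<i> * of_real w * (2 * \<i> * of_real w * h)
        - (- of_real (w^2) * h - of_real \<epsilon> * (2 * \<i> * of_real w * h) + of_real Q * g)
      = (- 3 * of_real (w^2) + 3/2 * \<i> * of_real (w * \<epsilon>)) * h - \<i> * of_real (Q * cxx / (2 * w))"
      unfolding QSg by (simp add: algebra_simps power2_eq_square)
    then show ?thesis
      unfolding hD by (simp add: algebra_simps power2_eq_square)
  qed
  have row3: "2 * \<i> * of_real w * g - (- of_real S * h) = of_real cxx * - \<i> * - \<i>"
    using assms(1) by (simp add: g_def field_simps)
  show "(mat (2 * \<i> * of_real w) - cmat (Jmat (w^2) \<epsilon> Q S)) *v
      vector [h, 2 * \<i> * of_real w * h, \<i> * (of_real cxx + of_real S * h) / (2 * of_real w)]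
      = bilin_xz bxx bxz bzz cxx q q"
    unfolding matrix_vector_mult_diff_rdistrib mat_mult_vector cmat_Jmat_mult bilin_xz_def q_def
      g_def[symmetric]
    by (simp only: vec3_eq_iff vector_minus_component vector_smult_component vector_3 row2 row3
        diff_self)
qed

lemma G21_Jmat_xz:
  fixes w \<epsilon> Q S bxx bxz bzz cxx dxxx dxxz dxzz exxx :: real and p :: "complex^3"
  defines "q \<equiv> vector [- \<i>, of_real w, of_real (S / w)] :: complex^3"
    and "A \<equiv> cmat (Jmat (w^2) \<epsilon> Q S)"
    and "B \<equiv> bilin_xz bxx bxz bzz cxx"
    and "C \<equiv> trilin_xz dxxx dxxz dxzz exxx"
    and "\<sigma> \<equiv> S / w"
  defines "u \<equiv> - cxx / S"
    and "t \<equiv> (bxx + bzz * \<sigma>^2 - w^2 * cxx / S) / Q"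
    and "h \<equiv> Complex (- bxx + \<sigma>^2 * bzz) (- 2 * \<sigma> * bxz + Q * cxx / (2 * w))
               / Complex (- 3 * w^2) (3/2 * w * \<epsilon>)"
  defines "K0 \<equiv> Complex (\<sigma> * dxxz - bxz * cxx / (2 * w) - 2 * (bxz * \<sigma> * u + bzz * \<sigma> * t)
                          - Q * exxx / w + 2 * Q * cxx * u / w)
                   (- dxxx - \<sigma>^2 * dxzz + \<sigma> * bzz * cxx / (2 * w) + 2 * bxx * u + 2 * bxz * t)"
    and "K1 \<equiv> Complex (\<sigma> * bxz - bxz * S / (2 * w) + Q * cxx / w) (bxx + \<sigma> * bzz * S / (2 * w))"
  assumes "w > 0" "Q \<noteq> 0" "S \<noteq> 0" "Q * S = \<epsilon> * w^2"
    and "transpose A *v p = (- \<i> * of_real w) *s p" "cpair p q = 1"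
  shows "cpair p (C q q (cvec_cnj q) + B (cvec_cnj q) (matrix_inv (mat (2 * \<i> * of_real w) - A) *v B q q)
            - 2 *s B q (matrix_inv A *v B q (cvec_cnj q)))
         = (K0 + K1 * h) / (2 * (of_real w - \<i> * of_real \<epsilon>))"
proof -
  have inverse: "matrix_inv A *v B q (cvec_cnj q) = vector [of_real u, 0, of_real t]"
    using bilin_xz_Jmat_inverse[OF assms(12,13), where W = "w^2" and \<epsilon> = \<epsilon> and w = w and \<sigma> = \<sigma>
        and bxx = bxx and bxz = bxz and bzz = bzz and cxx = cxx]
    unfolding A_def B_def q_def u_def t_def \<sigma>_def .
  have resolvent: "matrix_inv (mat (2 * \<i> * of_real w) - A) *v B q q
      = vector [h, 2 * \<i> * of_real w * h, \<i> * (of_real cxx + of_real S * h) / (2 * of_real w)]"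
    using bilin_xz_Jmat_resolvent[OF assms(11-14), where \<sigma> = \<sigma>
        and bxx = bxx and bxz = bxz and bzz = bzz and cxx = cxx]
    unfolding A_def B_def q_def h_def \<sigma>_def .
  define V where "V = C q q (cvec_cnj q) + B (cvec_cnj q) (matrix_inv (mat (2 * \<i> * of_real w) - A) *v B q q)
      - 2 *s B q (matrix_inv A *v B q (cvec_cnj q))"
  have "V$1 = 0"
    by (simp add: V_def B_def C_def bilin_xz_def trilin_xz_def)
  then have "cpair p V = (V$2 - \<i> * of_real (Q / w) * V$3) / (2 * (of_real w - \<i> * of_real \<epsilon>))"
    using cpair_adjoint_Jmat[OF assms(11,14)] assms(15,16) by (simp add: A_def q_def)
  also have "V$2 - \<i> * of_real (Q / w) * V$3 = K0 + K1 * h"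
    unfolding V_def inverse resolvent
    unfolding B_def C_def bilin_xz_def trilin_xz_def q_def cvec_cnj_def K0_def K1_def Complex_eq
      \<sigma>_def[symmetric]
    by (simp add: field_simps power2_eq_square less_imp_neq[OF assms(11), symmetric])
  finally show ?thesis
    unfolding V_def .
qed

text \<open>\<open>G21\<close> at \<open>P0\<close> as a function of \<open>r = sqrt \<beta>\<close>, \<open>w\<close>, \<open>z0\<close> and \<open>\<alpha>\<close>, after clearing the
  denominator of the first entry of \<open>h20\<close>.\<close>

definition G21_num :: "real \<Rightarrow> real \<Rightarrow> real \<Rightarrow> real \<Rightarrow> complex" where
  "G21_num r w z a = (let b = r^2; s = w * r; \<epsilon> = 2 * a * b^2 * z; k = 2 * b^2 - 1 in
     Complex (- 10 * a * z * b * s * r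
                - 2 * (2 * a * z * r * b * k / s + 2 * a * r * s * (a^2 * b^2 - 1) / z + 2 * a * z * r * b^3 / s)
                + a * b * r * z * k / s)
             (- (4 / b - 7 * b) - 2 * a^2 * b * k - 2 * (3 * b - 2 * k * (a^2 * b^2 - 1) / b) - a^2 * b^3)
       * Complex (- 3 * w^2) (3/2 * w * \<epsilon>)
     + Complex (s * (3 + 2 * a^2 * b^2)) (- (a * r * z * (9 * b^2 - 4)))
       * Complex (- a * r * z) (s * (a^2 * b^2 - 3)))"

definition G21_den :: "real \<Rightarrow> real \<Rightarrow> real \<Rightarrow> real \<Rightarrow> complex" where
  "G21_den r w z a = (let \<epsilon> = 2 * a * (r^2)^2 * z in
     2 * Complex w (- \<epsilon>) * Complex (- 3 * w^2) (3/2 * w * \<epsilon>))"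

lemma G21_closed_form:
  fixes r w z a b s \<epsilon> :: real and p :: "complex^3"
  assumes pos: "r > 0" "w > 0" "z > 0" "a > 0"
    and hb: "b = r^2" and hs: "s = w * r" and he: "\<epsilon> = 2 * a * b^2 * z"
  defines "A \<equiv> cmat (Jmat (w^2) \<epsilon> (2 * z * b * s) (a * s))"
    and "B \<equiv> bilin_xz (- 3 * s) (2 * z * (2 * b^2 - 1)) (2 * b * s) (- a * b)"
    and "C \<equiv> trilin_xz (4 / b - 7 * b) (- 8 * z * s * b) (2 * (2 * b^2 - 1)) (a * s)"
    and "q \<equiv> vector [- \<i>, of_real w, of_real (a * r)] :: complex^3"
  assumes adj: "transpose A *v p = (- \<i> * of_real w) *s p" "cpair p q = 1"
  shows "cpair p (C q q (cvec_cnj q) + B (cvec_cnj q) (matrix_inv (mat (2 * \<i> * of_real w) - A) *v B q q)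
            - 2 *s B q (matrix_inv A *v B q (cvec_cnj q)))
         = G21_num r w z a / G21_den r w z a"
proof -
  have bp: "b > 0" and sp: "s > 0"
    using pos unfolding hb hs by auto
  have QS: "(2 * z * b * s) * (a * s) = \<epsilon> * w^2"
    unfolding he hs hb by (simp add: power2_eq_square)
  have Q: "2 * z * b * s \<noteq> 0" and S: "a * s \<noteq> 0"
    using pos bp sp by auto
  have Sw: "a * s / w = a * r" and u: "- (- a * b) / (a * s) = b / s"
    and t: "(- 3 * s + 2 * b * s * (a * r)^2 - w^2 * (- a * b) / (a * s)) / (2 * z * b * s)
              = (a^2 * b^2 - 1) / (z * b)"
    using pos bp sp unfolding hs hb by (simp_all add: field_simps power2_eq_square)
  note G21 = G21_Jmat_xz[OF pos(2) Q S QS, where bxx = "- 3 * s" and bxz = "2 * z * (2 * b^2 - 1)"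
      and bzz = "2 * b * s" and cxx = "- a * b" and dxxx = "4 / b - 7 * b" and dxxz = "- 8 * z * s * b"
      and dxzz = "2 * (2 * b^2 - 1)" and exxx = "a * s", unfolded Sw u t, folded A_def B_def C_def q_def, OF adj]
  define D1 where "D1 = Complex (- 3 * w^2) (3/2 * w * \<epsilon>)"
  define N1 where "N1 = Complex (s * (3 + 2 * a^2 * b^2)) (- (a * r * z * (9 * b^2 - 4)))"
  define M where "M = Complex (- a * r * z) (s * (a^2 * b^2 - 3))"
  define K where "K = Complex (- 10 * a * z * b * s * r
      - 2 * (2 * a * z * r * b * (2 * b^2 - 1) / s + 2 * a * r * s * (a^2 * b^2 - 1) / z + 2 * a * z * r * b^3 / s)
      + a * b * r * z * (2 * b^2 - 1) / s)
    (- (4 / b - 7 * b) - 2 * a^2 * b * (2 * b^2 - 1) - 2 * (3 * b - 2 * (2 * b^2 - 1) * (a^2 * b^2 - 1) / b) - a^2 * b^3)"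
  have D1: "D1 \<noteq> 0"
    using pos by (simp add: D1_def Complex_eq_0)
  have "G21_num r w z a / G21_den r w z a = (K * D1 + N1 * M) / (2 * Complex w (- \<epsilon>) * D1)"
    unfolding G21_num_def G21_den_def Let_def K_def D1_def N1_def M_def
      hb[symmetric] hs[symmetric] he[symmetric] ..
  also have "\<dots> = (K + M * (N1 / D1)) / (2 * (of_real w - \<i> * of_real \<epsilon>))"
    using D1 by (simp add: Complex_eq field_simps)
  finally have closed_form:
    "G21_num r w z a / G21_den r w z a = (K + M * (N1 / D1)) / (2 * (of_real w - \<i> * of_real \<epsilon>))" .
  show ?thesis
    unfolding G21 closed_form
    apply (rule arg_cong[where f = "\<lambda>x. x / (2 * (of_real w - \<i> * of_real \<epsilon>))"])
    apply (rule arg_cong2[where f = "(+)"])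
    subgoal using pos unfolding K_def by (simp add: hb hs he field_simps power2_eq_square eval_nat_numeral)
    apply (rule arg_cong2[where f = "(*)"])
    subgoal using pos unfolding M_def by (simp add: hb hs he field_simps power2_eq_square)
    apply (rule arg_cong2[where f = "(/)"])
    subgoal using pos unfolding N1_def by (simp add: hb hs he field_simps power2_eq_square)
    subgoal unfolding D1_def by simp
    done
qed

lemma Re_G21_num:
  assumes "r > 0" "w > 0" "z > 0"
  shows "Re (G21_num r w z a) * (r^3 * w * z)
    = - 12 * r^5 * w^4 * a + 30 * r^7 * w^4 * z^2 * a + 24 * r^9 * w^2 * z^2 * a + 12 * r^9 * w^4 * a^3"
  using assms unfolding G21_num_def Let_def
  by (simp add: field_simps) algebra

lemma Im_G21_num:
  assumes "r > 0" "w > 0" "z > 0"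
  shows "Im (G21_num r w z a) * (r^3 * w * z)
    = - 4 * r^5 * w * z^3 * a^2 + 12 * r^5 * w^3 * z + 6 * r^5 * w^3 * z * a^2 + 18 * r^9 * w * z^3 * a^2
      - 30 * r^11 * w^3 * z^3 * a^2 - 30 * r^13 * w * z^3 * a^2 - 10 * r^13 * w^3 * z * a^4"
  using assms unfolding G21_num_def Let_def
  by (simp add: field_simps) algebra

lemma Re_G21_quotient:
  fixes r w z a b s \<epsilon> :: real
  assumes pos: "r > 0" "w > 0" "z > 0" "a > 0"
    and hb: "b = r^2" and hs: "s = w * r" and he: "\<epsilon> = 2 * a * b^2 * z"
  shows "Re (G21_num r w z a / G21_den r w z a) = 4 * a
      * (s^4 * (2 - 5 * b * z^2 - 2 * a^2 * b^2)
         + s^2 * (2 * b^3 * z^2 + 3 * a^2 * b^3 * z^2 - 4 * a^2 * b^5 * z^2 - a^4 * b^7 * z^2 - 5 * a^2 * b^6 * z^4)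
         - 2 * a^2 * b^4 * z^4 + 9 * a^2 * b^6 * z^4 - 7 * a^2 * b^8 * z^4)
      / (b * z * (w^2 + \<epsilon>^2) * (4 * w^2 + \<epsilon>^2))"
proof -
  define P where "P = s^4 * (2 - 5 * b * z^2 - 2 * a^2 * b^2)
         + s^2 * (2 * b^3 * z^2 + 3 * a^2 * b^3 * z^2 - 4 * a^2 * b^5 * z^2 - a^4 * b^7 * z^2 - 5 * a^2 * b^6 * z^4)
         - 2 * a^2 * b^4 * z^4 + 9 * a^2 * b^6 * z^4 - 7 * a^2 * b^8 * z^4"
  let ?X = "Re (G21_num r w z a) * Re (G21_den r w z a) + Im (G21_num r w z a) * Im (G21_den r w z a)"
  have den: "Re (G21_den r w z a) = 2 * (- 3 * w^3 + 3/2 * w * \<epsilon>^2)"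
    "Im (G21_den r w z a) = 9 * w^2 * \<epsilon>"
    unfolding G21_den_def Let_def he hb by (simp_all add: power2_eq_square power3_eq_cube algebra_simps)
  have norm: "(Re (G21_den r w z a))^2 + (Im (G21_den r w z a))^2 = 9 * w^2 * (w^2 + \<epsilon>^2) * (4 * w^2 + \<epsilon>^2)"
    unfolding den by algebra
  have "?X * (r^3 * w * z) = Re (G21_num r w z a) * (r^3 * w * z) * Re (G21_den r w z a)
      + Im (G21_num r w z a) * (r^3 * w * z) * Im (G21_den r w z a)"
    by (simp add: algebra_simps)
  also have "\<dots> = 36 * a * w^3 * r * P"
    unfolding Re_G21_num[OF pos(1-3)] Im_G21_num[OF pos(1-3)] den P_def he hs hb by algebra
  finally have "?X * (r^3 * w * z) = 36 * a * w^3 * r * P" .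
  then have "?X = 36 * a * w^3 * r * P / (r^3 * w * z)"
    using pos by (simp add: eq_divide_eq)
  also have "\<dots> = 36 * a * w^2 * P / (b * z)"
    using pos unfolding hb by (simp add: power2_eq_square power3_eq_cube)
  finally have X: "?X = 36 * a * w^2 * P / (b * z)" .
  have nz: "w^2 + \<epsilon>^2 > 0" "4 * w^2 + \<epsilon>^2 > 0" "b > 0"
    using pos unfolding hb by (simp_all add: add_pos_nonneg)
  have "Re (G21_num r w z a / G21_den r w z a) = ?X / ((Re (G21_den r w z a))^2 + (Im (G21_den r w z a))^2)"
    by (simp only: Re_divide)
  also have "\<dots> = 36 * a * w^2 * P / (b * z) / (9 * w^2 * (w^2 + \<epsilon>^2) * (4 * w^2 + \<epsilon>^2))"
    unfolding X norm ..
  also have "\<dots> = 4 * a * P / (b * z * (w^2 + \<epsilon>^2) * (4 * w^2 + \<epsilon>^2))"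
    using pos nz by (simp add: divide_divide_eq_left frac_eq_eq)
  finally show ?thesis
    unfolding P_def .
qed

section \<open>The equilibrium P0\<close>

text \<open>In the notation of the corollary, \<open>s = sin x\<close>, \<open>z0\<close> is the \<open>z\<close>-coordinate of \<open>P0\<close>,
  \<open>w = \<omega>0\<close> and \<open>eps_c = \<epsilon>c\<close>.\<close>

locale rho0_system =
  fixes \<alpha> \<beta> \<kappa> :: real
  assumes alpha_pos: "0 < \<alpha>" and beta_pos: "0 < \<beta>" and beta_less_1: "\<beta> < 1"
    and kappa_less_1: "\<kappa> < 1"
begin

definition r :: real where "r = sqrt \<beta>"
definition s :: real where "s = sqrt (1 - \<beta>^2)"
definition z0 :: real where "z0 = sqrt (1 / \<beta> - \<kappa>)"
definition w :: real where "w = s / r"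
definition eps_c :: real where "eps_c = 2 * \<alpha> * \<beta>^2 * z0"
definition P0 :: "real^3" where "P0 = vector [arccos \<beta>, 0, z0]"
definition G1 :: real where "G1 = -3 + 5*\<kappa>*\<beta> - (\<alpha>^2 - 5)*\<beta>^2 + \<kappa>*(\<alpha>^2 - 7)*\<beta>^3 - 2*\<alpha>^2*\<kappa>^2*\<beta>^4
              - (\<alpha>^4 - 2*\<alpha>^2*\<kappa>^2)*\<beta>^6 + \<alpha>^4*\<kappa>*\<beta>^7"

lemma r_pos: "0 < r" and r_sq: "r^2 = \<beta>"
  using beta_pos by (simp_all add: r_def)

lemma s_pos: "0 < s" and s_sq: "s^2 = 1 - \<beta>^2"
proof -
  have "\<beta>^2 < 1"
    using beta_pos beta_less_1 by (simp add: power_less_one_iff abs_less_iff)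
  then show "0 < s" "s^2 = 1 - \<beta>^2"
    by (simp_all add: s_def)
qed

lemma z0_pos: "0 < z0" and z0_sq: "z0^2 + \<kappa> = 1 / \<beta>"
proof -
  have "1 < 1 / \<beta>"
    using beta_pos beta_less_1 by simp
  then show "0 < z0" "z0^2 + \<kappa> = 1 / \<beta>"
    using kappa_less_1 by (simp_all add: z0_def)
qed

lemma w_pos: "0 < w" and s_eq: "s = w * r" and w_sq: "w^2 = s^2 / \<beta>"
  using s_pos r_pos r_sq by (simp_all add: w_def power_divide)

lemma omega0_eq: "sqrt ((1 - \<beta>^2) powr (3/2) / (\<beta> * sqrt (1 - \<beta>^2))) = w"
proof -
  have pos: "0 < 1 - \<beta>^2"
    using s_pos by (simp flip: s_sq)
  then have "(1 - \<beta>^2) powr (3/2) = (1 - \<beta>^2) * (1 - \<beta>^2) powr (1/2)"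
    using powr_add[of "1 - \<beta>^2" 1 "1/2"] by simp
  also have "\<dots> = s^2 * s"
    using pos by (simp add: s_sq powr_half_sqrt flip: s_def)
  finally have "(1 - \<beta>^2) powr (3/2) / (\<beta> * sqrt (1 - \<beta>^2)) = w^2"
    using s_pos unfolding s_def[symmetric] w_sq by (simp add: power2_eq_square)
  then show ?thesis
    using w_pos by simp
qed

lemma eps_c_powr_eq: "2 * \<alpha> * \<beta> powr (3/2) * sqrt (1 - \<kappa> * \<beta>) = eps_c"
proof -
  have "\<beta> powr (3/2) = \<beta> * r"
    using beta_pos powr_add[of \<beta> 1 "1/2"] by (simp add: r_def powr_half_sqrt)
  moreover have "1 - \<kappa> * \<beta> = (r * z0)^2"
    using z0_sq beta_pos by (simp add: power_mult_distrib r_sq) (simp add: field_simps)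
  then have "sqrt (1 - \<kappa> * \<beta>) = r * z0"
    using r_pos z0_pos by simp
  ultimately show ?thesis
    using r_sq unfolding eps_c_def by algebra
qed

lemma q_entry3_eq: "\<alpha> * sqrt \<beta> * sqrt ((1 - \<beta>^2) / \<beta>) / w = \<alpha> * r"
  using s_pos r_pos by (simp add: real_sqrt_divide w_def flip: r_def s_def)

lemma cos_x0: "cos (arccos \<beta>) = \<beta>" and sin_x0: "sin (arccos \<beta>) = s"
  using beta_pos beta_less_1 by (simp_all add: s_def sin_arccos)

lemma cos_2x0: "cos (2 * arccos \<beta>) = 2 * \<beta>^2 - 1" and sin_2x0: "sin (2 * arccos \<beta>) = 2 * \<beta> * s"
  using s_sq by (simp_all add: cos_double sin_double cos_x0 sin_x0)

lemma sys_P0: "sys 0 \<kappa> \<alpha> \<beta> \<epsilon> P0 = 0"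
proof -
  have "(z0^2 + \<kappa>) * s * \<beta> = s"
    unfolding z0_sq using beta_pos by simp
  then show ?thesis
    by (simp add: sys_def P0_def vec3_eq_iff cos_x0 sin_x0)
qed

lemma jac_P0: "jac (sys 0 \<kappa> \<alpha> \<beta> \<epsilon>) P0 = Jmat (w^2) \<epsilon> (2 * z0 * \<beta> * s) (\<alpha> * s)"
proof -
  have "sys2_x \<kappa> (arccos \<beta>) z0 = - (w^2)"
    using beta_pos unfolding sys2_x_def z0_sq cos_2x0 cos_x0 w_sq s_sq by (simp add: field_simps power2_eq_square)
  then show ?thesis
    by (simp add: jac_sys P0_def Jmat_def sys2_z_def sys3_x_def sin_2x0 sin_x0)
      (simp add: mult_ac)
qed

lemma Bform_P0: "Bform (sys 0 \<kappa> \<alpha> \<beta> \<epsilon>) P0 =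
    bilin_xz (- 3 * s) (2 * z0 * (2 * \<beta>^2 - 1)) (2 * \<beta> * s) (- \<alpha> * \<beta>)"
proof -
  have "sys2_xx \<kappa> (arccos \<beta>) z0 = - 3 * s"
    using beta_pos unfolding sys2_xx_def z0_sq sin_2x0 sin_x0 by (simp add: field_simps)
  then show ?thesis
    by (simp add: Bform_sys P0_def sys2_xz_def sys2_zz_def sys3_xx_def cos_2x0 sin_2x0 cos_x0)
qed

lemma Cform_P0: "Cform (sys 0 \<kappa> \<alpha> \<beta> \<epsilon>) P0 =
    trilin_xz (4 / \<beta> - 7 * \<beta>) (- 8 * z0 * s * \<beta>) (2 * (2 * \<beta>^2 - 1)) (\<alpha> * s)"
proof -
  have "sys2_xxx \<kappa> (arccos \<beta>) z0 = 4 / \<beta> - 7 * \<beta>"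
    using beta_pos unfolding sys2_xxx_def z0_sq cos_2x0 cos_x0 by (simp add: field_simps power2_eq_square)
  then show ?thesis
    by (simp add: Cform_sys P0_def sys2_xxz_def sys2_xzz_def sys3_xxx_def cos_2x0 sin_2x0 sin_x0)
      (simp add: mult_ac)
qed

lemma QS_eq: "(2 * z0 * \<beta> * s) * (\<alpha> * s) = eps_c * w^2"
  unfolding eps_c_def w_sq using beta_pos by (simp add: field_simps power2_eq_square)

lemma QS_pos: "0 < (2 * z0 * \<beta> * s) * (\<alpha> * s)"
  using z0_pos beta_pos s_pos alpha_pos by simp

lemma imaginary_eigenvalue_iff:
  "(\<exists>\<omega>>0. is_eigenvalue (cmat (jac (sys 0 \<kappa> \<alpha> \<beta> \<epsilon>) P0)) (\<i> * of_real \<omega>)) \<longleftrightarrow> \<epsilon> = eps_c"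
proof -
  have "(2 * z0 * \<beta> * s) * (\<alpha> * s) = \<epsilon> * w^2 \<longleftrightarrow> \<epsilon> = eps_c"
    using w_pos unfolding QS_eq by auto
  then show ?thesis
    using QS_pos w_pos unfolding jac_P0
    by (subst positive_imaginary_eigenvalue_Jmat_iff) auto
qed

lemma hopf_jacobian_P0: "hopf_jacobian (jac (sys 0 \<kappa> \<alpha> \<beta> eps_c) P0) w"
  unfolding jac_P0 using w_pos QS_pos QS_eq by (rule hopf_jacobian_Jmat)

lemma transversal_P0: "transversal (\<lambda>\<epsilon>. jac (sys 0 \<kappa> \<alpha> \<beta> \<epsilon>) P0) eps_c w"
proof -
  have "0 < eps_c"
    using alpha_pos beta_pos z0_pos by (simp add: eps_c_def)
  then have "transversal (\<lambda>\<epsilon>. Jmat (w^2) \<epsilon> (2 * z0 * \<beta> * s) (\<alpha> * s)) eps_c (sqrt (w^2))"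
    using w_pos QS_pos QS_eq by (intro transversal_Jmat) auto
  then show ?thesis
    using w_pos by (simp add: jac_P0)
qed

lemma adjoint_vector_exists:
  "\<exists>p. adj_vec (jac (sys 0 \<kappa> \<alpha> \<beta> eps_c) P0) w (vector [- \<i>, of_real w, of_real (\<alpha> * r)]) p"
proof -
  have "\<alpha> * s / w = \<alpha> * r"
    using w_pos s_eq by simp
  then show ?thesis
    using adjoint_exists_Jmat[OF w_pos QS_eq] by (simp add: adj_vec_def jac_P0)
qed

lemma G1_identity:
  "s^4 * (2 - 5 * \<beta> * z0^2 - 2 * \<alpha>^2 * \<beta>^2)
   + s^2 * (2 * \<beta>^3 * z0^2 + 3 * \<alpha>^2 * \<beta>^3 * z0^2 - 4 * \<alpha>^2 * \<beta>^5 * z0^2 - \<alpha>^4 * \<beta>^7 * z0^2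
            - 5 * \<alpha>^2 * \<beta>^6 * z0^4)
   - 2 * \<alpha>^2 * \<beta>^4 * z0^4 + 9 * \<alpha>^2 * \<beta>^6 * z0^4 - 7 * \<alpha>^2 * \<beta>^8 * z0^4 = s^2 * G1"
proof -
  have \<kappa>: "\<kappa> * \<beta> = 1 - z0^2 * \<beta>"
    using z0_sq beta_pos by (simp add: field_simps)
  have s4: "s^4 = (1 - \<beta>^2)^2"
    by (simp flip: s_sq)
  show ?thesis
    unfolding G1_def s4 s_sq using \<kappa> by algebra
qed

lemma lyap1_P0:
  assumes "adj_vec (jac (sys 0 \<kappa> \<alpha> \<beta> eps_c) P0) w (vector [- \<i>, of_real w, of_real (\<alpha> * r)]) p"
  shows "lyap1 (sys 0 \<kappa> \<alpha> \<beta> eps_c) P0 w (vector [- \<i>, of_real w, of_real (\<alpha> * r)]) p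
    = 2 * \<alpha> * s^2 * G1 / (\<beta> * z0 * w * (w^2 + eps_c^2) * (4 * w^2 + eps_c^2))"
proof -
  from assms have adj:
    "transpose (cmat (Jmat (w^2) eps_c (2 * z0 * \<beta> * s) (\<alpha> * s))) *v p = (- \<i> * of_real w) *s p"
    "cpair p (vector [- \<i>, of_real w, of_real (\<alpha> * r)]) = 1"
    unfolding adj_vec_def jac_P0 by auto
  have "G21 (sys 0 \<kappa> \<alpha> \<beta> eps_c) P0 w (vector [- \<i>, of_real w, of_real (\<alpha> * r)]) p
      = G21_num r w z0 \<alpha> / G21_den r w z0 \<alpha>"
    unfolding G21_def Let_def jac_P0 Bform_P0 Cform_P0
    by (rule G21_closed_form[OF r_pos w_pos z0_pos alpha_pos r_sq[symmetric] s_eq eps_c_def adj])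
  then have "Re (G21 (sys 0 \<kappa> \<alpha> \<beta> eps_c) P0 w (vector [- \<i>, of_real w, of_real (\<alpha> * r)]) p)
      = 4 * \<alpha> * (s^2 * G1) / (\<beta> * z0 * (w^2 + eps_c^2) * (4 * w^2 + eps_c^2))"
    using Re_G21_quotient[OF r_pos w_pos z0_pos alpha_pos r_sq[symmetric] s_eq eps_c_def]
    by (simp add: G1_identity)
  then show ?thesis
    using w_pos by (simp add: lyap1_def) (simp add: mult_ac)
qed

lemma lyap1_P0_eq_0_iff:
  assumes "adj_vec (jac (sys 0 \<kappa> \<alpha> \<beta> eps_c) P0) w (vector [- \<i>, of_real w, of_real (\<alpha> * r)]) p"
  shows "lyap1 (sys 0 \<kappa> \<alpha> \<beta> eps_c) P0 w (vector [- \<i>, of_real w, of_real (\<alpha> * r)]) p = 0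
    \<longleftrightarrow> G1 = 0"
proof -
  have "0 < w^2 + eps_c^2" "0 < 4 * w^2 + eps_c^2"
    using w_pos by (simp_all add: add_pos_nonneg)
  then show ?thesis
    unfolding lyap1_P0[OF assms] using alpha_pos beta_pos z0_pos w_pos s_pos by simp
qed

end

theorem corollary3p4:
  fixes \<alpha> \<beta> \<kappa> :: real
  assumes "0 < \<beta>" "\<beta> < 1" "0 < \<alpha>" "0 \<le> \<kappa>" "\<kappa> < 1"
  defines "F \<equiv> (\<lambda>\<epsilon>. sys 0 \<kappa> \<alpha> \<beta> \<epsilon>)"
    and "P0 \<equiv> (vector [arccos \<beta>, 0, sqrt (1 / \<beta> - \<kappa>)] :: real^3)"
    and "\<epsilon>c \<equiv> 2 * \<alpha> * \<beta> powr (3/2) * sqrt (1 - \<kappa> * \<beta>)"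
    and "\<omega>0 \<equiv> sqrt ((1 - \<beta>^2) powr (3/2) / (\<beta> * sqrt (1 - \<beta>^2)))"
    and "q \<equiv> (vector [- \<i>,
              complex_of_real (sqrt ((1 - \<beta>^2) powr (3/2) / (\<beta> * sqrt (1 - \<beta>^2)))),
              complex_of_real (\<alpha> * sqrt \<beta> * sqrt ((1 - \<beta>^2) / \<beta>)
                 / sqrt ((1 - \<beta>^2) powr (3/2) / (\<beta> * sqrt (1 - \<beta>^2))))] :: complex^3)"
    and "G1 \<equiv> -3 + 5*\<kappa>*\<beta> - (\<alpha>^2 - 5)*\<beta>^2 + \<kappa>*(\<alpha>^2 - 7)*\<beta>^3 - 2*\<alpha>^2*\<kappa>^2*\<beta>^4
              - (\<alpha>^4 - 2*\<alpha>^2*\<kappa>^2)*\<beta>^6 + \<alpha>^4*\<kappa>*\<beta>^7"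
  shows "(\<forall>\<epsilon>. F \<epsilon> P0 = 0)
       \<and> (\<forall>\<epsilon>. (\<exists>\<omega>>0. is_eigenvalue (cmat (jac (F \<epsilon>) P0)) (\<i> * of_real \<omega>)) \<longleftrightarrow> \<epsilon> = \<epsilon>c)
       \<and> (\<exists>p. adj_vec (jac (F \<epsilon>c) P0) \<omega>0 q p)
       \<and> (\<forall>p. adj_vec (jac (F \<epsilon>c) P0) \<omega>0 q p \<longrightarrow> (lyap1 (F \<epsilon>c) P0 \<omega>0 q p = 0 \<longleftrightarrow> G1 = 0))
       \<and> (G1 \<noteq> 0 \<longrightarrow>
            hopf_jacobian (jac (F \<epsilon>c) P0) \<omega>0
          \<and> transversal (\<lambda>\<epsilon>. jac (F \<epsilon>) P0) \<epsilon>c \<omega>0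
          \<and> (\<forall>p. adj_vec (jac (F \<epsilon>c) P0) \<omega>0 q p \<longrightarrow> lyap1 (F \<epsilon>c) P0 \<omega>0 q p \<noteq> 0))"
proof -
  interpret H: rho0_system \<alpha> \<beta> \<kappa>
    using assms(1-3,5) by unfold_locales
  have "P0 = H.P0" "\<epsilon>c = H.eps_c" "\<omega>0 = H.w" "q = vector [- \<i>, of_real H.w, of_real (\<alpha> * H.r)]"
    "G1 = H.G1"
    unfolding P0_def H.P0_def H.z0_def \<epsilon>c_def H.eps_c_powr_eq \<omega>0_def q_def H.omega0_eq H.q_entry3_eq
      G1_def H.G1_def
    by simp_all
  then show ?thesis
    unfolding F_def using H.sys_P0 H.imaginary_eigenvalue_iff H.adjoint_vector_exists H.lyap1_P0_eq_0_iff
      H.hopf_jacobian_P0 H.transversal_P0 by auto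
qed

end
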